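(* Let $G$ be a finite group and let $X$ be a $G$-space. Assume that $X$ admits an equivariant $n$-mean for some multiple $n$ of $|G|$. (1) For every subgroup $H\leq G$, the set $X^H=\{x\in X: hx=x\text{ for each }h\in H\}$ is a retract of $X$. (2) If $X$ is an AR, then $X^H$ is an AR for every subgroup $H\leq G$, and $X$ is a $G$-AR.
   Context: All spaces are Hausdorff and "map" means continuous function. A $G$-space is a topological space $X$ with a continuous action $G\times X\to X$ of the Hausdorff topological group $G$ (a finite group is thus discrete). A subset $A$ of a $G$-space is invariant if $ga\in A$ for all $g\in G$, $a\in A$. A function $f$ between $G$-spaces is equivariant if $f(gx)=gf(x)$ for all $g,x$. An $n$-mean on a topological space $X$ is a continuous map $p:X^n\to X$ such that $p(x,\dots,x)=x$ for all $x\in X$ and $p(x_1,\dots,x_n)=p(x_{\sigma(1)},\dots,x_{\sigma(n)})$ for all $(x_1,\dots,x_n)\in X^n$ and all permutations $\sigma$ of $\{1,\dots,n\}$. On a $G$-space it is equivariant if $p(gx_1,\dots,gx_n)=g\,p(x_1,\dots,x_n)$ for all $g\in G$ and $(x_1,\dots,x_n)\in X^n$. A metrizable $G$-space $Y$ is a $G$-AR ($G$-absolute retract) if for every metrizable $G$-space $Z$ containing $Y$ as a closed invariant subset there is a (continuous) equivariant retraction $r:Z\to Y$. An AR is this notion for the trivial group (in particular, an AR is metrizable). *)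

theory Defs
  imports
    "HOL-Analysis.Analysis"
    "HOL-Algebra.Group_Action"
    "HOL-Algebra.Elementary_Groups"
begin

definition Hausdorff_topological_group ::
    "('g, 'm) monoid_scheme \<Rightarrow> 'g topology \<Rightarrow> bool" where
  "Hausdorff_topological_group G T \<longleftrightarrow>
     group G \<and> topspace T = carrier G \<and> Hausdorff_space T \<and>
     continuous_map (prod_topology T T) T (\<lambda>(g, h). g \<otimes>\<^bsub>G\<^esub> h) \<and>
     continuous_map T T (\<lambda>g. inv\<^bsub>G\<^esub> g)"

text \<open>The library's group actions consist of bijections that are extensional, i.e. take the value
  \<^const>\<open>undefined\<close> outside the space. This only fixes a representative of each action.\<close>

definition G_space ::
    "('g, 'm) monoid_scheme \<Rightarrow> 'g topology \<Rightarrow> 'a topology \<Rightarrow> ('g \<Rightarrow> 'a \<Rightarrow> 'a) \<Rightarrow> bool" where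
  "G_space G T X \<phi> \<longleftrightarrow>
     Hausdorff_topological_group G T \<and> Hausdorff_space X \<and>
     group_action G (topspace X) \<phi> \<and>
     continuous_map (prod_topology T X) X (\<lambda>(g, x). \<phi> g x)"

definition equivariant_on ::
    "('g, 'm) monoid_scheme \<Rightarrow> 'a set \<Rightarrow> ('g \<Rightarrow> 'a \<Rightarrow> 'a) \<Rightarrow> ('g \<Rightarrow> 'b \<Rightarrow> 'b) \<Rightarrow>
     ('a \<Rightarrow> 'b) \<Rightarrow> bool" where
  "equivariant_on G A \<phi> \<psi> f \<longleftrightarrow> (\<forall>g\<in>carrier G. \<forall>x\<in>A. f (\<phi> g x) = \<psi> g (f x))"

definition invariant_set ::
    "('g, 'm) monoid_scheme \<Rightarrow> ('g \<Rightarrow> 'a \<Rightarrow> 'a) \<Rightarrow> 'a set \<Rightarrow> bool" where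
  "invariant_set G \<phi> A \<longleftrightarrow> (\<forall>g\<in>carrier G. \<forall>a\<in>A. \<phi> g a \<in> A)"

definition fixed_set :: "'g set \<Rightarrow> ('g \<Rightarrow> 'a \<Rightarrow> 'a) \<Rightarrow> 'a topology \<Rightarrow> 'a set" where
  "fixed_set H \<phi> X = {x \<in> topspace X. \<forall>h\<in>H. \<phi> h x = x}"

text \<open>Points of \<open>X\<^sup>n\<close> are extensional functions on \<^term>\<open>{1..n}\<close>, as in
  \<^const>\<open>product_topology\<close>; hence the restricted abstractions.\<close>

definition n_mean :: "nat \<Rightarrow> 'a topology \<Rightarrow> ((nat \<Rightarrow> 'a) \<Rightarrow> 'a) \<Rightarrow> bool" where
  "n_mean n X p \<longleftrightarrow>
     continuous_map (product_topology (\<lambda>_. X) {1..n}) X p \<and>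
     (\<forall>x\<in>topspace X. p (\<lambda>i\<in>{1..n}. x) = x) \<and>
     (\<forall>x \<in> {1..n} \<rightarrow>\<^sub>E topspace X. \<forall>\<sigma>. \<sigma> permutes {1..n} \<longrightarrow>
        p (\<lambda>i\<in>{1..n}. x (\<sigma> i)) = p x)"

definition equivariant_n_mean ::
    "('g, 'm) monoid_scheme \<Rightarrow> nat \<Rightarrow> 'a topology \<Rightarrow> ('g \<Rightarrow> 'a \<Rightarrow> 'a) \<Rightarrow>
     ((nat \<Rightarrow> 'a) \<Rightarrow> 'a) \<Rightarrow> bool" where
  "equivariant_n_mean G n X \<phi> p \<longleftrightarrow>
     n_mean n X p \<and>
     (\<forall>g\<in>carrier G. \<forall>x \<in> {1..n} \<rightarrow>\<^sub>E topspace X.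
        p (\<lambda>i\<in>{1..n}. \<phi> g (x i)) = \<phi> g (p x))"

text \<open>HOL cannot quantify over all spaces \<open>Z\<close> inside a formula, so the type \<^typ>\<open>'z\<close> of the points
  of the test spaces is a parameter; a space is a \<open>G\<close>-AR outright if it is one for every
  \<^typ>\<open>'z\<close>. Accordingly a conclusion should be stated for an arbitrary \<^typ>\<open>'z\<close>, while assuming the
  property for a single type only makes a theorem stronger. As \<open>Y\<close> and \<open>Z\<close> live on different types, ``\<open>Z\<close> contains \<open>Y\<close> as a closed invariant
  subset'' is expressed by an equivariant embedding \<open>e\<close> of \<open>Y\<close> into \<open>Z\<close> with closed invariant
  image. (The library's \<^term>\<open>AR\<close> concerns subsets of Euclidean spaces only.)\<close>

definition G_AR ::
    "'z itself \<Rightarrow> ('g, 'm) monoid_scheme \<Rightarrow> 'g topology \<Rightarrow> 'a topology \<Rightarrow>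
     ('g \<Rightarrow> 'a \<Rightarrow> 'a) \<Rightarrow> bool" where
  "G_AR _ G T Y \<phi> \<longleftrightarrow>
     G_space G T Y \<phi> \<and> metrizable_space Y \<and>
     (\<forall>(Z :: 'z topology) \<psi> e.
        G_space G T Z \<psi> \<and> metrizable_space Z \<and>
        embedding_map Y Z e \<and> equivariant_on G (topspace Y) \<phi> \<psi> e \<and>
        closedin Z (e ` topspace Y) \<and> invariant_set G \<psi> (e ` topspace Y) \<longrightarrow>
        (\<exists>r. continuous_map Z (subtopology Z (e ` topspace Y)) r \<and>
             equivariant_on G (topspace Z) \<psi> \<psi> r \<and>
             (\<forall>y \<in> e ` topspace Y. r y = y)))"

definition AR_space :: "'z itself \<Rightarrow> 'a topology \<Rightarrow> bool" where
  "AR_space TZ Y \<longleftrightarrow>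
     G_AR TZ (singleton_group ()) (discrete_topology {()}) Y (\<lambda>_. \<lambda>y\<in>topspace Y. y)"

lemma singleton_group_action_iff:
  "group_action (singleton_group ()) E \<phi> \<longleftrightarrow> \<phi> = (\<lambda>_. \<lambda>y\<in>E. y)"
proof
  assume a: "group_action (singleton_group ()) E \<phi>"
  have "\<phi> \<one>\<^bsub>singleton_group ()\<^esub> = \<one>\<^bsub>BijGroup E\<^esub>"
    using a group_action.group_hom group_hom.hom_one by blast
  then show "\<phi> = (\<lambda>_. \<lambda>y\<in>E. y)"
    by (auto simp: BijGroup_def fun_eq_iff)
next
  assume "\<phi> = (\<lambda>_. \<lambda>y\<in>E. y)"
  moreover have "group_hom (singleton_group ()) (BijGroup E) (\<lambda>_. \<one>\<^bsub>BijGroup E\<^esub>)"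
    by (simp add: group_hom_def group_hom_axioms_def group_BijGroup hom_def
        group.is_monoid monoid.one_closed)
  ultimately show "group_action (singleton_group ()) E \<phi>"
    by (simp add: group_action_def BijGroup_def)
qed

lemma G_space_singleton_group_iff:
  "G_space (singleton_group ()) (discrete_topology {()}) X \<phi> \<longleftrightarrow>
     Hausdorff_space X \<and> \<phi> = (\<lambda>_. \<lambda>y\<in>topspace X. y)"
proof -
  have "Hausdorff_topological_group (singleton_group ()) (discrete_topology {()})"
    by (simp add: Hausdorff_topological_group_def continuous_map_def case_prod_unfold)
  moreover have "continuous_map (prod_topology (discrete_topology {()}) X) X
      (\<lambda>(g, x). (\<lambda>y\<in>topspace X. y) x)"
    by (rule continuous_map_eq[OF continuous_map_snd]) (auto simp: restrict_def)
  ultimately show ?thesis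
    unfolding G_space_def singleton_group_action_iff by blast
qed

lemma AR_space_iff:
  "AR_space TYPE('z) Y \<longleftrightarrow>
     metrizable_space Y \<and>
     (\<forall>(Z :: 'z topology) e.
        metrizable_space Z \<and> embedding_map Y Z e \<and> closedin Z (e ` topspace Y) \<longrightarrow>
        (e ` topspace Y) retract_of_space Z)"
proof -
  have triv: "(\<exists>r. continuous_map Z (subtopology Z (e ` topspace Y)) r \<and>
             equivariant_on (singleton_group ()) (topspace Z)
               (\<lambda>_. \<lambda>z\<in>topspace Z. z) (\<lambda>_. \<lambda>z\<in>topspace Z. z) r \<and>
             (\<forall>y \<in> e ` topspace Y. r y = y)) \<longleftrightarrow> (e ` topspace Y) retract_of_space Z"
      "equivariant_on (singleton_group ()) (topspace Y)
         (\<lambda>_. \<lambda>y\<in>topspace Y. y) (\<lambda>_. \<lambda>z\<in>topspace Z. z) e"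
      "invariant_set (singleton_group ()) (\<lambda>_. \<lambda>z\<in>topspace Z. z) (e ` topspace Y)"
    if "closedin Z (e ` topspace Y)" for Z :: "'z topology" and e
  proof -
    have sub: "e ` topspace Y \<subseteq> topspace Z"
      using closedin_subset[OF that] .
    have "equivariant_on (singleton_group ()) (topspace Z)
            (\<lambda>_. \<lambda>z\<in>topspace Z. z) (\<lambda>_. \<lambda>z\<in>topspace Z. z) r"
      if "continuous_map Z (subtopology Z (e ` topspace Y)) r" for r
    proof -
      have "\<forall>z\<in>topspace Z. r z \<in> topspace Z"
        using that by (auto simp: continuous_map_in_subtopology continuous_map_def)
      then show ?thesis
        by (simp add: equivariant_on_def)
    qed
    then show "(\<exists>r. continuous_map Z (subtopology Z (e ` topspace Y)) r \<and>
             equivariant_on (singleton_group ()) (topspace Z)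
               (\<lambda>_. \<lambda>z\<in>topspace Z. z) (\<lambda>_. \<lambda>z\<in>topspace Z. z) r \<and>
             (\<forall>y \<in> e ` topspace Y. r y = y)) \<longleftrightarrow> (e ` topspace Y) retract_of_space Z"
      using sub unfolding retract_of_space_def by blast
    show "equivariant_on (singleton_group ()) (topspace Y)
         (\<lambda>_. \<lambda>y\<in>topspace Y. y) (\<lambda>_. \<lambda>z\<in>topspace Z. z) e"
      using sub by (simp add: equivariant_on_def image_subset_iff)
    show "invariant_set (singleton_group ()) (\<lambda>_. \<lambda>z\<in>topspace Z. z) (e ` topspace Y)"
      using sub by (simp add: invariant_set_def image_subset_iff)
  qed
  show ?thesis
    unfolding AR_space_def G_AR_def G_space_singleton_group_iff
    by (smt (verit) triv metrizable_imp_Hausdorff_space)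
qed

end

theory Submission
  imports Defs
begin

text \<open>
  The mean averages over a finite group. If \<open>H \<le> G\<close>, then \<open>|H|\<close> divides \<open>n\<close>, so every family
  \<open>(f k)\<close> indexed by \<open>k \<in> H\<close> can be fed to the \<open>n\<close>-mean with each member repeated \<open>n/|H|\<close> times.
  As the mean is symmetric, the result does not change when \<open>H\<close> is permuted, in particular when \<open>k\<close>
  is replaced by \<open>h k\<close> or \<open>k h\<close>; as it is equivariant, the group action can be pulled out. Hence
  \<open>x \<mapsto> mean (k x)\<close> over \<open>k \<in> H\<close> takes its values in \<open>X\<^sup>H\<close>, and it fixes the points of \<open>X\<^sup>H\<close> because
  the mean is idempotent. This is \<open>fixed_set_retract\<close>.

  If \<open>X\<close> sits equivariantly as a closed subset of \<open>Z\<close> and \<open>r : Z \<rightarrow> X\<close> is any retraction, then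
  \<open>z \<mapsto> mean (k\<^sup>-\<^sup>1 (r (k z)))\<close> over \<open>k \<in> G\<close> is an equivariant retraction. This is
  \<open>average_retraction\<close>, and it makes every AR with such a mean a \<open>G\<close>-AR.

  That \<open>X\<^sup>H\<close> is an AR now only needs that a retract \<open>A\<close> of an AR \<open>X\<close> is an AR
  (\<open>AR_space_retract\<close>). Suppose that \<open>A\<close> is a closed subset of \<open>Z\<close>. Gluing \<open>Z\<close> and \<open>X\<close> along \<open>A\<close>
  gives a space \<open>W\<close> that contains \<open>X\<close> as a closed subset; if \<open>W\<close> is metrizable, then \<open>W\<close> retracts to
  \<open>X\<close>, and \<open>Z \<rightarrow> W \<rightarrow> X \<rightarrow> A\<close> is the retraction sought. In general, metrizing \<open>W\<close> requires
  Hausdorff's theorem on extending metrics, but here the retraction \<open>X \<rightarrow> A\<close> yields an explicit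
  metric (\<open>metrizable_gluing_along_retract\<close>).
\<close>

section \<open>Averaging over a finite group\<close>

text \<open>
  This says that all fibres of the indexing \<open>a\<close> have the same size. It is expressed by what the means
  use: every permutation of \<open>S\<close> is induced by a permutation of the indices. For \<open>n = 0\<close> it is
  vacuously true.
\<close>
definition balanced_index :: "nat \<Rightarrow> (nat \<Rightarrow> 's) \<Rightarrow> 's set \<Rightarrow> bool" where
  "balanced_index n a S \<longleftrightarrow>
     a \<in> {1..n} \<rightarrow> S \<and>
     (\<forall>\<tau>. bij_betw \<tau> S S \<longrightarrow>
        (\<exists>\<sigma>. \<sigma> permutes {1..n} \<and> (\<forall>i\<in>{1..n}. \<tau> (a i) = a (\<sigma> i))))"

text \<open>
  With \<open>n = |S| m\<close>, the indices are in bijection with \<open>S \<times> {..<m}\<close>, on which a permutation of \<open>S\<close>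
  acts through the first factor.
\<close>
lemma balanced_index_exists:
  assumes "finite S" and "card S dvd n"
  obtains a where "balanced_index n a S"
proof -
  obtain m where m: "n = card S * m"
    using assms(2) by blast
  have "card {1..n} = card (S \<times> {..<m})"
    using m by (simp add: card_cartesian_product)
  then obtain b where b: "bij_betw b {1..n} (S \<times> {..<m})"
    using assms(1) finite_same_card_bij[of "{1..n}" "S \<times> {..<m}"] by auto
  define b' where "b' = inv_into {1..n} b"
  have b': "bij_betw b' (S \<times> {..<m}) {1..n}"
    unfolding b'_def by (rule bij_betw_inv_into[OF b])
  have bb': "b (b' y) = y" if "y \<in> S \<times> {..<m}" for y
    using bij_betw_inv_into_right[OF b that] by (simp add: b'_def)
  define a where "a = fst \<circ> b"
  have "\<exists>\<sigma>. \<sigma> permutes {1..n} \<and> (\<forall>i\<in>{1..n}. \<tau> (a i) = a (\<sigma> i))"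
    if \<tau>: "bij_betw \<tau> S S" for \<tau>
  proof -
    have t: "bij_betw (map_prod \<tau> id) (S \<times> {..<m}) (S \<times> {..<m})"
      by (rule bij_betw_map_prod[OF \<tau> bij_betw_id])
    define \<sigma>0 where "\<sigma>0 = b' \<circ> map_prod \<tau> id \<circ> b"
    define \<sigma> where "\<sigma> = (\<lambda>i. if i \<in> {1..n} then \<sigma>0 i else i)"
    have "bij_betw \<sigma>0 {1..n} {1..n}"
      unfolding \<sigma>0_def using bij_betw_trans[OF bij_betw_trans[OF b t] b'] by (simp add: o_assoc)
    then have "bij_betw \<sigma> {1..n} {1..n}"
      by (rule bij_betw_cong[THEN iffD1, rotated]) (simp add: \<sigma>_def)
    then have "\<sigma> permutes {1..n}"
      by (rule bij_imp_permutes) (auto simp: \<sigma>_def)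
    moreover have "\<tau> (a i) = a (\<sigma> i)" if i: "i \<in> {1..n}" for i
    proof -
      have "map_prod \<tau> id (b i) \<in> S \<times> {..<m}"
        using i b t by (meson bij_betwE)
      then have "b (\<sigma> i) = map_prod \<tau> id (b i)"
        using i bb' by (simp add: \<sigma>_def \<sigma>0_def)
      then show ?thesis
        by (simp add: a_def)
    qed
    ultimately show ?thesis
      by blast
  qed
  moreover have "a \<in> {1..n} \<rightarrow> S"
    using bij_betwE[OF b] by (force simp: a_def)
  ultimately show thesis
    using that unfolding balanced_index_def by blast
qed

definition family_mean :: "((nat \<Rightarrow> 'a) \<Rightarrow> 'a) \<Rightarrow> nat \<Rightarrow> (nat \<Rightarrow> 's) \<Rightarrow> ('s \<Rightarrow> 'a) \<Rightarrow> 'a" where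
  "family_mean p n a f = p (\<lambda>i\<in>{1..n}. f (a i))"

lemma family_mean_cong:
  assumes "balanced_index n a S" and "\<And>s. s \<in> S \<Longrightarrow> f s = g s"
  shows "family_mean p n a f = family_mean p n a g"
proof -
  have "(\<lambda>i\<in>{1..n}. f (a i)) = (\<lambda>i\<in>{1..n}. g (a i))"
    using assms by (intro restrict_ext) (simp add: balanced_index_def Pi_iff)
  then show ?thesis
    by (simp add: family_mean_def)
qed

text \<open>
  The two retractions below are the identity where they should be because there the averaged family is
  constant. For \<open>n = 0\<close> the family is not consulted at all, but then the idempotence of \<open>p\<close> forces
  \<open>X\<close> to have at most one point.
\<close>
lemma family_mean_const:
  assumes "n_mean n X p" "balanced_index n a S" "x \<in> topspace X" "\<And>s. s \<in> S \<Longrightarrow> f s = x"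
  shows "family_mean p n a f = x"
proof -
  have "family_mean p n a f = family_mean p n a (\<lambda>_. x)"
    using assms by (intro family_mean_cong) auto
  then show ?thesis
    using assms(1,3) by (simp add: family_mean_def n_mean_def)
qed

lemma family_mean_reindex:
  assumes p: "n_mean n X p" and a: "balanced_index n a S" and f: "f \<in> S \<rightarrow> topspace X"
    and \<tau>: "bij_betw \<tau> S S"
  shows "family_mean p n a (\<lambda>s. f (\<tau> s)) = family_mean p n a f"
proof -
  obtain \<sigma> where \<sigma>: "\<sigma> permutes {1..n}" "\<forall>i\<in>{1..n}. \<tau> (a i) = a (\<sigma> i)"
    using a \<tau> by (auto simp: balanced_index_def)
  let ?x = "\<lambda>i\<in>{1..n}. f (a i)"
  have "(\<lambda>i\<in>{1..n}. f (\<tau> (a i))) = (\<lambda>i\<in>{1..n}. ?x (\<sigma> i))"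
  proof (rule restrict_ext)
    fix i assume i: "i \<in> {1..n}"
    then have "\<sigma> i \<in> {1..n}"
      using permutes_in_image[OF \<sigma>(1)] by blast
    then show "f (\<tau> (a i)) = ?x (\<sigma> i)"
      using \<sigma>(2) i by simp
  qed
  moreover have "?x \<in> {1..n} \<rightarrow>\<^sub>E topspace X"
    using a f by (auto simp: balanced_index_def)
  then have "p (\<lambda>i\<in>{1..n}. ?x (\<sigma> i)) = p ?x"
    using p \<sigma>(1) unfolding n_mean_def by blast
  ultimately show ?thesis
    by (simp add: family_mean_def)
qed

lemma family_mean_equivariant:
  assumes p: "equivariant_n_mean G n X \<phi> p" and a: "balanced_index n a S"
    and f: "f \<in> S \<rightarrow> topspace X" and g: "g \<in> carrier G"
  shows "family_mean p n a (\<lambda>s. \<phi> g (f s)) = \<phi> g (family_mean p n a f)"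
proof -
  let ?x = "\<lambda>i\<in>{1..n}. f (a i)"
  have "?x \<in> {1..n} \<rightarrow>\<^sub>E topspace X"
    using a f by (auto simp: balanced_index_def)
  then have "p (\<lambda>i\<in>{1..n}. \<phi> g (?x i)) = \<phi> g (p ?x)"
    using p g unfolding equivariant_n_mean_def by blast
  moreover have "(\<lambda>i\<in>{1..n}. \<phi> g (?x i)) = (\<lambda>i\<in>{1..n}. \<phi> g (f (a i)))"
    by (rule restrict_ext) simp
  ultimately show ?thesis
    by (simp add: family_mean_def)
qed

lemma continuous_map_family_mean:
  assumes p: "n_mean n X p" and a: "balanced_index n a S"
    and F: "\<And>s. s \<in> S \<Longrightarrow> continuous_map Z X (\<lambda>z. F z s)"
  shows "continuous_map Z X (\<lambda>z. family_mean p n a (F z))"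
proof -
  have "continuous_map Z (product_topology (\<lambda>_. X) {1..n}) (\<lambda>z. \<lambda>i\<in>{1..n}. F z (a i))"
    using a F by (auto simp: continuous_map_componentwise balanced_index_def)
  then have "continuous_map Z X (p \<circ> (\<lambda>z. \<lambda>i\<in>{1..n}. F z (a i)))"
    using p unfolding n_mean_def by (intro continuous_map_compose) auto
  then show ?thesis
    by (simp add: family_mean_def o_def)
qed

lemma G_space_continuous_action:
  assumes "G_space G T X \<phi>" and "g \<in> carrier G"
  shows "continuous_map X X (\<phi> g)"
proof -
  have T: "g \<in> topspace T"
    using assms by (simp add: G_space_def Hausdorff_topological_group_def)
  have "continuous_map X (prod_topology T X) (\<lambda>x. (g, x))"
    using T by (intro continuous_map_pairedI) auto
  then have "continuous_map X X ((\<lambda>(g, x). \<phi> g x) \<circ> (\<lambda>x. (g, x)))"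
    using assms(1) unfolding G_space_def by (blast intro: continuous_map_compose)
  then show ?thesis
    by (simp add: o_def)
qed

text \<open>
  The average \<open>r x\<close> of the orbit family \<open>k \<mapsto> k x\<close> is fixed by \<open>h \<in> H\<close> since left translation by \<open>h\<close>
  permutes that family.
\<close>
lemma fixed_set_retract:
  fixes G (structure)
  assumes X: "G_space G T X \<phi>" and H: "subgroup H G" and "finite H" and "card H dvd n"
    and p: "equivariant_n_mean G n X \<phi> p"
  shows "fixed_set H \<phi> X retract_of_space X"
proof -
  interpret group_action G "topspace X" \<phi>
    using X by (simp add: G_space_def)
  interpret group G
    using group_hom by (rule group_hom.axioms)
  interpret H: subgroup H G
    by (rule H)
  have nm: "n_mean n X p"
    using p by (simp add: equivariant_n_mean_def)
  obtain a where a: "balanced_index n a H"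
    using balanced_index_exists assms by blast
  define r where "r x = family_mean p n a (\<lambda>k. \<phi> k x)" for x
  have cont: "continuous_map X X r"
    unfolding r_def using G_space_continuous_action[OF X] H.mem_carrier
    by (intro continuous_map_family_mean[OF nm a]) auto
  have act: "\<phi> k x \<in> topspace X" if "k \<in> H" "x \<in> topspace X" for k x
    using element_image[OF H.mem_carrier _ refl] that by simp
  have "\<phi> h (r x) = r x" if h: "h \<in> H" and x: "x \<in> topspace X" for h x
  proof -
    have "\<phi> h (r x) = family_mean p n a (\<lambda>k. \<phi> h (\<phi> k x))"
      unfolding r_def using act h x by (intro family_mean_equivariant[OF p a, symmetric]) auto
    also have "\<dots> = family_mean p n a (\<lambda>k. \<phi> (h \<otimes> k) x)"
      using h x by (intro family_mean_cong[OF a]) (simp add: composition_rule)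
    also have "\<dots> = r x"
    proof -
      have "bij_betw (\<lambda>k. h \<otimes> k) H H"
        using h by (intro bij_betw_byWitness[where f' = "\<lambda>k. inv h \<otimes> k"])
          (auto simp: m_assoc[symmetric])
      then show ?thesis
        unfolding r_def using act x
        by (intro family_mean_reindex[OF nm a, of "\<lambda>k. \<phi> k x"]) auto
    qed
    finally show ?thesis .
  qed
  then have "r ` topspace X \<subseteq> fixed_set H \<phi> X"
    using cont by (auto simp: fixed_set_def continuous_map_def)
  then have "continuous_map X (subtopology X (fixed_set H \<phi> X)) r"
    using cont by (auto simp: continuous_map_in_subtopology)
  moreover have "r x = x" if "x \<in> fixed_set H \<phi> X" for x
    unfolding r_def using that by (intro family_mean_const[OF nm a]) (auto simp: fixed_set_def)
  ultimately show ?thesis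
    unfolding retract_of_space_def by (auto simp: fixed_set_def)
qed

text \<open>
  For the family \<open>F z k = k\<^sup>-\<^sup>1 r (k z)\<close>, with \<open>r\<close> read as a map into \<open>X\<close>, one has
  \<open>F (h z) k = h (F z (k h))\<close>. So the average at \<open>h z\<close> is \<open>h\<close> applied to the average at \<open>z\<close> of the
  family reindexed by right translation. On the image of \<open>X\<close> the family is constant because that
  image is invariant and \<open>r\<close> is the identity there.
\<close>
lemma average_retraction:
  fixes G (structure)
  assumes X: "G_space G T X \<phi>" and Z: "G_space G T Z \<psi>" and "finite (carrier G)"
    and "order G dvd n" and p: "equivariant_n_mean G n X \<phi> p"
    and e: "embedding_map X Z e" "equivariant_on G (topspace X) \<phi> \<psi> e"
    and r: "(e ` topspace X) retract_of_space Z"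
  shows "\<exists>R. continuous_map Z (subtopology Z (e ` topspace X)) R \<and>
             equivariant_on G (topspace Z) \<psi> \<psi> R \<and> (\<forall>y \<in> e ` topspace X. R y = y)"
proof -
  interpret X: group_action G "topspace X" \<phi>
    using X by (simp add: G_space_def)
  interpret Z: group_action G "topspace Z" \<psi>
    using Z by (simp add: G_space_def)
  interpret group G
    using X.group_hom by (rule group_hom.axioms)
  let ?E = "subtopology Z (e ` topspace X)"
  have nm: "n_mean n X p"
    using p by (simp add: equivariant_n_mean_def)
  obtain a where a: "balanced_index n a (carrier G)"
    using balanced_index_exists assms unfolding order_def by blast
  obtain s where s: "homeomorphic_maps X ?E e s"
    using e(1) by (auto simp: embedding_map_def homeomorphic_map_maps)
  obtain r where r: "continuous_map Z ?E r" "\<And>y. y \<in> e ` topspace X \<Longrightarrow> r y = y"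
    using r by (auto simp: retract_of_space_def)
  have ce: "continuous_map X ?E e" and cs: "continuous_map ?E X s"
    and se: "\<And>x. x \<in> topspace X \<Longrightarrow> s (e x) = x"
    using s by (auto simp: homeomorphic_maps_def)
  have csr: "continuous_map Z X (\<lambda>z. s (r z))"
    using continuous_map_compose[OF r(1) cs] by (simp add: o_def)
  define F where "F z k = \<phi> (inv k) (s (r (\<psi> k z)))" for z k
  define q where "q z = family_mean p n a (F z)" for z
  have cF: "continuous_map Z X (\<lambda>z. F z k)" if "k \<in> carrier G" for k
    using continuous_map_compose[OF continuous_map_compose[OF G_space_continuous_action[OF Z that] csr]
        G_space_continuous_action[OF X inv_closed[OF that]]]
    by (simp add: F_def o_def)
  then have cq: "continuous_map Z X q"
    unfolding q_def by (intro continuous_map_family_mean[OF nm a]) auto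
  have FX: "F z k \<in> topspace X" if "k \<in> carrier G" "z \<in> topspace Z" for z k
    using cF[OF that(1)] that(2) by (auto simp: continuous_map_def)
  have sX: "s (r z) \<in> topspace X" if "z \<in> topspace Z" for z
    using csr that by (auto simp: continuous_map_def)
  have q_equi: "q (\<psi> h z) = \<phi> h (q z)" if h: "h \<in> carrier G" and z: "z \<in> topspace Z" for h z
  proof -
    have "F (\<psi> h z) k = \<phi> h (F z (k \<otimes> h))" if k: "k \<in> carrier G" for k
    proof -
      have kz: "\<psi> (k \<otimes> h) z \<in> topspace Z"
        using h k z Z.element_image by blast
      then have "\<phi> h (F z (k \<otimes> h)) = \<phi> (h \<otimes> inv (k \<otimes> h)) (s (r (\<psi> (k \<otimes> h) z)))"
        unfolding F_def using h k by (simp add: X.composition_rule sX)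
      also have "h \<otimes> inv (k \<otimes> h) = inv k"
        using h k by (simp add: inv_mult_group m_assoc[symmetric])
      finally show ?thesis
        unfolding F_def using h k z by (simp add: Z.composition_rule)
    qed
    then have "q (\<psi> h z) = family_mean p n a (\<lambda>k. \<phi> h (F z (k \<otimes> h)))"
      unfolding q_def by (intro family_mean_cong[OF a])
    also have "\<dots> = \<phi> h (family_mean p n a (\<lambda>k. F z (k \<otimes> h)))"
      using FX h z by (intro family_mean_equivariant[OF p a]) auto
    also have "family_mean p n a (\<lambda>k. F z (k \<otimes> h)) = q z"
    proof -
      have "bij_betw (\<lambda>k. k \<otimes> h) (carrier G) (carrier G)"
        using h by (intro bij_betw_byWitness[where f' = "\<lambda>k. k \<otimes> inv h"]) (auto simp: m_assoc)
      then show ?thesis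
        unfolding q_def using FX z by (intro family_mean_reindex[OF nm a, of "F z"]) auto
    qed
    finally show ?thesis .
  qed
  have q_id: "q (e x) = x" if x: "x \<in> topspace X" for x
  proof -
    have "F (e x) k = x" if k: "k \<in> carrier G" for k
    proof -
      have kx: "\<phi> k x \<in> topspace X"
        using k x X.element_image by blast
      have "\<psi> k (e x) = e (\<phi> k x)"
        using e(2) k x by (simp add: equivariant_on_def)
      then have "F (e x) k = \<phi> (inv k) (\<phi> k x)"
        using kx by (simp add: F_def r(2) se)
      also have "\<dots> = x"
        using X.orbit_sym_aux[OF k x refl] .
      finally show ?thesis .
    qed
    then show ?thesis
      unfolding q_def using x by (intro family_mean_const[OF nm a]) auto
  qed
  have "continuous_map Z ?E (\<lambda>z. e (q z))"
    using continuous_map_compose[OF cq ce] by (simp add: o_def)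
  moreover have "equivariant_on G (topspace Z) \<psi> \<psi> (\<lambda>z. e (q z))"
    unfolding equivariant_on_def
  proof (intro ballI)
    fix h z assume h: "h \<in> carrier G" and z: "z \<in> topspace Z"
    have "q z \<in> topspace X"
      using cq z by (auto simp: continuous_map_def)
    then show "e (q (\<psi> h z)) = \<psi> h (e (q z))"
      using e(2) h z q_equi by (simp add: equivariant_on_def)
  qed
  ultimately show ?thesis
    using q_id by (intro exI[of _ "\<lambda>z. e (q z)"]) auto
qed

section \<open>Retracts of absolute retracts\<close>

text \<open>
  \<open>W\<close> is the union of \<open>Z\<close> and \<open>X - A\<close>, the points of \<open>A\<close> being represented by their images in \<open>Z\<close>.
  Two continuous maps determine it: \<open>\<pi> : W \<rightarrow> Z\<close>, which is \<open>e \<circ> \<rho>\<close> on \<open>X\<close>, and the collapse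
  \<open>W \<rightarrow> X/A\<close>, which sends \<open>Z\<close> to the base point. The metric of \<open>W\<close> is the one induced from
  \<open>Z \<times> X/A\<close>, where \<open>X/A\<close> carries the usual quotient metric \<open>min (d' x y) (u x + u y)\<close>, with \<open>u\<close>
  the distance to the base point.

  The choice of \<open>u\<close> is what makes this work. The distance from \<open>x\<close> to \<open>A\<close> would not do: a
  sequence \<open>x\<^sub>n\<close> could come close to \<open>A\<close>, with \<open>\<rho> x\<^sub>n\<close> converging, and yet not converge, as \<open>\<rho>\<close>
  need not be uniformly continuous. With \<open>u x = d x (\<rho> x)\<close> this cannot happen. The price is that \<open>u\<close>
  is 1-Lipschitz, as the triangle inequality for the quotient metric requires, only for the enlarged
  metric \<open>d' x y = d x y + d (\<rho> x) (\<rho> y)\<close>, which induces the same topology as \<open>d\<close>.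
\<close>
lemma metrizable_gluing_along_retract:
  fixes X :: "'a topology" and Z :: "'z topology" and e :: "'a \<Rightarrow> 'z"
  assumes "metrizable_space X" and "metrizable_space Z"
    and \<rho>: "continuous_map X (subtopology X A) \<rho>" "\<And>x. x \<in> A \<Longrightarrow> \<rho> x = x"
    and A: "A \<subseteq> topspace X"
    and e: "embedding_map (subtopology X A) Z e" and cl: "closedin Z (e ` A)"
  shows "\<exists>W :: ('z + 'a) topology. metrizable_space W \<and> continuous_map Z W Inl \<and>
     embedding_map X W (\<lambda>x. if x \<in> A then Inl (e x) else Inr x) \<and>
     closedin W ((\<lambda>x. if x \<in> A then Inl (e x) else Inr x) ` topspace X)"
proof -
  obtain MX d where dX: "Metric_space MX d" "X = Metric_space.mtopology MX d"
    using assms(1) by (auto simp: metrizable_space_def)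
  obtain MZ c where cZ: "Metric_space MZ c" "Z = Metric_space.mtopology MZ c"
    using assms(2) by (auto simp: metrizable_space_def)
  interpret X: Metric_space MX d
    by (rule dX(1))
  interpret Z: Metric_space MZ c
    by (rule cZ(1))
  have tX: "topspace X = MX" and tZ: "topspace Z = MZ"
    using dX(2) cZ(2) by auto
  have AX: "A \<subseteq> MX"
    using A tX by simp
  have \<rho>A: "\<rho> x \<in> A" if "x \<in> MX" for x
    using \<rho>(1) that tX by (auto simp: continuous_map_def)
  have \<rho>X: "\<rho> x \<in> MX" if "x \<in> MX" for x
    using \<rho>A[OF that] AX by auto
  have ta: "topspace (subtopology X A) = A"
    using A by auto
  obtain s where s: "homeomorphic_maps (subtopology X A) (subtopology Z (e ` A)) e s"
    using e ta by (auto simp: embedding_map_def homeomorphic_map_maps)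
  have ce: "continuous_map (subtopology X A) Z e"
    using s by (auto simp: homeomorphic_maps_def continuous_map_in_subtopology)
  have cs: "continuous_map (subtopology Z (e ` A)) X s"
    using s by (auto simp: homeomorphic_maps_def continuous_map_in_subtopology)
  have se: "s (e x) = x" if "x \<in> A" for x
    using s that ta by (auto simp: homeomorphic_maps_def)
  have eZ: "e x \<in> MZ" if "x \<in> A" for x
    using ce that ta tZ by (auto simp: continuous_map_def)
  have c\<rho>: "continuous_map X X \<rho>"
    using \<rho>(1) by (simp add: continuous_map_in_subtopology)
  have ce\<rho>: "continuous_map X Z (\<lambda>x. e (\<rho> x))"
    using continuous_map_compose[OF \<rho>(1) ce] by (simp add: o_def)

  define u where "u x = d x (\<rho> x)" for x
  define d' where "d' x y = d x y + d (\<rho> x) (\<rho> y)" for x y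
  have d'0: "d' x y = 0 \<longleftrightarrow> x = y" if "x \<in> MX" "y \<in> MX" for x y
    using that \<rho>X X.nonneg[of x y] X.nonneg[of "\<rho> x" "\<rho> y"]
    by (auto simp: d'_def add_nonneg_eq_0_iff)
  have d'sym: "d' x y = d' y x" for x y
    by (simp add: d'_def X.commute)
  have d'ge: "0 \<le> d' x y" for x y
    by (simp add: d'_def)
  have d'tri: "d' x z \<le> d' x y + d' y z" if "x \<in> MX" "y \<in> MX" "z \<in> MX" for x y z
    using X.triangle[of x y z] X.triangle[of "\<rho> x" "\<rho> y" "\<rho> z"] that \<rho>X by (simp add: d'_def)
  have u0: "0 \<le> u x" for x
    by (simp add: u_def)
  have uA: "u x = 0" if "x \<in> A" for x
    using \<rho>(2) that AX by (auto simp: u_def)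
  have unA: "0 < u x" if "x \<in> MX" "x \<notin> A" for x
    using that \<rho>A[of x] \<rho>X[of x] X.mdist_pos_eq[of x "\<rho> x"] unfolding u_def by auto
  have uL: "u x \<le> d' x y + u y" if "x \<in> MX" "y \<in> MX" for x y
    using X.triangle[of x y "\<rho> x"] X.triangle[of y "\<rho> y" "\<rho> x"] X.commute[of "\<rho> x" "\<rho> y"] that \<rho>X
    by (simp add: u_def d'_def)
  \<comment> \<open>A sequence in \<open>X\<close> converges as soon as it does so in \<open>X/A\<close> and after applying \<open>\<rho>\<close>.\<close>
  have du: "d x y \<le> min (d' x y) (u x + u y) + d (\<rho> x) (\<rho> y)" if "x \<in> MX" "y \<in> MX" for x y
  proof -
    have "d x y \<le> u x + d (\<rho> x) (\<rho> y) + u y"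
      using X.triangle[of x "\<rho> x" y] X.triangle[of "\<rho> x" "\<rho> y" y] X.commute[of y "\<rho> y"] that \<rho>X
      by (simp add: u_def)
    then show ?thesis
      by (simp add: d'_def min_def)
  qed

  define M where "M = Inl ` MZ \<union> Inr ` (MX - A)"
  define \<pi> where "\<pi> = case_sum (\<lambda>z. z) (\<lambda>x. e (\<rho> x))"
  define v :: "'z + 'a \<Rightarrow> real" where "v = case_sum (\<lambda>_. 0) u"
  define m where "m w w' = (case (w, w') of (Inr x, Inr y) \<Rightarrow> min (d' x y) (u x + u y)
     | _ \<Rightarrow> v w + v w')" for w w'
  have m_simps [simp]: "m (Inl z) w = v w" "m w (Inl z) = v w"
      "m (Inr x) (Inr y) = min (d' x y) (u x + u y)" for z w x y
    by (auto simp: m_def v_def split: sum.splits)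
  have v_simps [simp]: "v (Inl z) = 0" "v (Inr x) = u x" for z x
    by (auto simp: v_def)
  have \<pi>_simps [simp]: "\<pi> (Inl z) = z" "\<pi> (Inr x) = e (\<rho> x)" for z x
    by (auto simp: \<pi>_def)
  define D where "D w w' = c (\<pi> w) (\<pi> w') + m w w'" for w w'
  have m0: "0 \<le> m w w'" for w w'
    by (cases w; cases w') (auto simp: u0 d'ge)
  have \<pi>M: "\<pi> w \<in> MZ" if "w \<in> M" for w
    using that \<rho>A eZ by (auto simp: M_def)
  have m_sym: "m w w' = m w' w" for w w'
    by (cases w; cases w') (auto simp: d'sym add.commute)
  have m_tri: "m w1 w3 \<le> m w1 w2 + m w2 w3" if "w1 \<in> M" "w2 \<in> M" "w3 \<in> M" for w1 w2 w3
  proof -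
    have *: "min (d' x z) (u x + u z) \<le> min (d' x y) (u x + u y) + min (d' y z) (u y + u z)"
      if "x \<in> MX" "y \<in> MX" "z \<in> MX" for x y z
      using uL[of x y] uL[of z y] d'sym[of z y] d'tri[of x y z] u0[of y] that
      by (simp add: min_def)
    have **: "u x \<le> min (d' x y) (u x + u y) + u y" if "x \<in> MX" "y \<in> MX" for x y
      using uL[of x y] u0[of y] that by (simp add: min_def)
    have ***: "u y \<le> u x + min (d' x y) (u x + u y)" if "x \<in> MX" "y \<in> MX" for x y
      using **[of y x] that by (simp add: d'sym add.commute)
    show ?thesis
      using that * ** *** u0 unfolding M_def
      by (cases w1; cases w2; cases w3) auto
  qed
  interpret W: Metric_space M D
  proof
    fix w w' show "0 \<le> D w w'"
      by (simp add: D_def m0)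
    show "D w w' = D w' w"
      by (simp add: D_def m_sym Z.commute)
  next
    fix w w' assume w: "w \<in> M" "w' \<in> M"
    have "D w w' = 0 \<longleftrightarrow> \<pi> w = \<pi> w' \<and> m w w' = 0"
      using m0[of w w'] w \<pi>M by (auto simp: D_def add_nonneg_eq_0_iff)
    also have "\<dots> \<longleftrightarrow> w = w'"
    proof (cases w; cases w')
      fix x y assume xy: "w = Inr x" "w' = Inr y"
      then have "0 < u x + u y" "x \<in> MX" "y \<in> MX"
        using w unA[of x] unA[of y] by (auto simp: M_def)
      then have "min (d' x y) (u x + u y) = 0 \<longleftrightarrow> x = y"
        using d'0[of x y] d'ge[of x y] by (auto simp: min_def split: if_splits)
      then show ?thesis
        using xy by auto
    qed (use w unA in \<open>auto simp: M_def; force\<close>)+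
    finally show "D w w' = 0 \<longleftrightarrow> w = w'" .
  next
    fix w1 w2 w3 assume "w1 \<in> M" "w2 \<in> M" "w3 \<in> M"
    then show "D w1 w3 \<le> D w1 w2 + D w2 w3"
      using m_tri[of w1 w2 w3] Z.triangle[of "\<pi> w1" "\<pi> w2" "\<pi> w3"] \<pi>M by (simp add: D_def)
  qed

  define i where "i x = (if x \<in> A then Inl (e x) else Inr x)" for x :: 'a
  have iM: "i x \<in> M" if "x \<in> MX" for x
    using that eZ by (auto simp: i_def M_def)
  have i_inj: "inj_on i (topspace X)"
    using se by (intro inj_onI) (metis i_def sum.inject sum.distinct(1))
  \<comment> \<open>If \<open>x\<close> or \<open>y\<close> lies in \<open>A\<close>, then \<open>m\<close> is given by \<open>u x + u y\<close>; this equals the minimum since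
      \<open>u\<close> vanishes on \<open>A\<close> and is 1-Lipschitz for \<open>d'\<close>.\<close>
  have Di: "D (i x) (i y) = c (e (\<rho> x)) (e (\<rho> y)) + min (d' x y) (u x + u y)"
    if "x \<in> MX" "y \<in> MX" for x y
  proof -
    have "\<pi> (i z) = e (\<rho> z)" for z
      using \<rho>(2) by (simp add: i_def)
    moreover have "m (i x) (i y) = min (d' x y) (u x + u y)"
      using uA uL[of x y] uL[of y x] d'sym[of x y] d'ge[of x y] that by (auto simp: i_def)
    ultimately show ?thesis
      by (simp add: D_def)
  qed
  have i_range: "w \<in> i ` MX" if "w \<in> M" "\<pi> w \<in> e ` A" for w
    using that AX by (force simp: M_def i_def)

  have cInl: "continuous_map Z W.mtopology Inl"
    unfolding cZ(2) Z.metric_continuous_map[OF W.Metric_space_axioms]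
    by (auto simp: M_def D_def)
  have ci: "continuous_map X W.mtopology i"
    unfolding W.continuous_map_to_metric
  proof (intro ballI allI impI)
    fix x and \<epsilon> :: real assume x: "x \<in> topspace X" and \<epsilon>: "0 < \<epsilon>"
    let ?r = "\<epsilon> / 3"
    let ?U = "X.mball x ?r \<inter> {y \<in> topspace X. \<rho> y \<in> X.mball (\<rho> x) ?r}
       \<inter> {y \<in> topspace X. e (\<rho> y) \<in> Z.mball (e (\<rho> x)) ?r}"
    have "openin X ?U"
      using openin_continuous_map_preimage[OF c\<rho>, of "X.mball (\<rho> x) ?r"]
        openin_continuous_map_preimage[OF ce\<rho>, of "Z.mball (e (\<rho> x)) ?r"]
      by (intro openin_Int) (simp_all add: dX(2) cZ(2))
    moreover have "x \<in> ?U"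
      using x \<epsilon> \<rho>X \<rho>A eZ tX by simp
    moreover have "i y \<in> W.mball (i x) \<epsilon>" if "y \<in> ?U" for y
      using that x iM tX by (auto simp: Di d'_def)
    ultimately show "\<exists>U. openin X U \<and> x \<in> U \<and> (\<forall>y\<in>U. i y \<in> W.mball (i x) \<epsilon>)"
      by blast
  qed
  have clo: "closed_map X W.mtopology i"
    unfolding closed_map_def W.metric_closedin_iff_sequentially_closed
  proof (intro allI impI conjI; (elim conjE)?)
    fix C assume C: "closedin X C"
    then have CX: "C \<subseteq> MX"
      using closedin_subset tX by blast
    then show "i ` C \<subseteq> M"
      using iM by auto
    fix \<sigma> l assume "range \<sigma> \<subseteq> i ` C" and l: "limitin W.mtopology \<sigma> l sequentially"
    then have "\<forall>k. \<exists>y. y \<in> C \<and> \<sigma> k = i y"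
      by blast
    then obtain \<tau> where \<tau>: "\<And>k. \<tau> k \<in> C" "\<And>k. \<sigma> k = i (\<tau> k)"
      by metis
    have \<tau>X: "\<tau> k \<in> MX" for k
      using \<tau>(1) CX by auto
    have lM: "l \<in> M" and D_lim: "(\<lambda>k. D (\<sigma> k) l) \<longlonglongrightarrow> 0"
      using l by (auto simp: W.limitin_metric_dist_null)
    have \<pi>\<sigma>: "\<pi> (\<sigma> k) = e (\<rho> (\<tau> k))" for k
      using \<tau>(2) \<rho>(2) by (simp add: i_def)
    have "(\<lambda>k. c (\<pi> (\<sigma> k)) (\<pi> l)) \<longlonglongrightarrow> 0"
      using m0 by (intro tendsto_sandwich[OF _ _ tendsto_const D_lim]) (auto simp: D_def)
    then have \<pi>_lim: "limitin Z (\<lambda>k. e (\<rho> (\<tau> k))) (\<pi> l) sequentially"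
      using \<pi>M[OF lM] eZ \<rho>A \<tau>X \<pi>\<sigma> unfolding cZ(2) Z.limitin_metric_dist_null by simp
    \<comment> \<open>The image of \<open>X\<close> in \<open>W\<close> is the preimage of \<open>e ` A\<close> under \<open>\<pi>\<close>, so the limit lies in it.\<close>
    then have \<pi>l: "\<pi> l \<in> e ` A"
      using limitin_closedin[OF \<pi>_lim cl] \<rho>A \<tau>X by auto
    then obtain x where x: "x \<in> MX" "l = i x"
      using i_range lM by blast
    have \<pi>x: "\<pi> l = e (\<rho> x)"
      using x(2) \<rho>(2) by (simp add: i_def)
    have "limitin (subtopology Z (e ` A)) (\<lambda>k. e (\<rho> (\<tau> k))) (\<pi> l) sequentially"
      using \<pi>_lim \<pi>l \<rho>A \<tau>X by (auto simp: limitin_subtopology)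
    then have "limitin X (s \<circ> (\<lambda>k. e (\<rho> (\<tau> k)))) (s (\<pi> l)) sequentially"
      by (rule continuous_map_limit[OF cs])
    then have "(\<lambda>k. d (\<rho> (\<tau> k)) (\<rho> x)) \<longlonglongrightarrow> 0"
      using se \<rho>A \<tau>X x(1) \<pi>x unfolding dX(2) X.limitin_metric_dist_null by simp
    then have lim: "(\<lambda>k. D (\<sigma> k) l + d (\<rho> (\<tau> k)) (\<rho> x)) \<longlonglongrightarrow> 0"
      using tendsto_add[OF D_lim] by fastforce
    have "d (\<tau> k) x \<le> D (\<sigma> k) l + d (\<rho> (\<tau> k)) (\<rho> x)" for k
      using du[OF \<tau>X x(1), of k] Z.nonneg Di[OF \<tau>X x(1), of k] \<tau>(2) x(2)
      by (smt (verit))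
    then have "(\<lambda>k. d (\<tau> k) x) \<longlonglongrightarrow> 0"
      by (intro tendsto_sandwich[OF _ _ tendsto_const lim]) auto
    then have "limitin X \<tau> x sequentially"
      using \<tau>X x(1) unfolding dX(2) X.limitin_metric_dist_null by simp
    then have "x \<in> C"
      by (rule limitin_closedin[OF _ C]) (simp_all add: \<tau>(1))
    then show "l \<in> i ` C"
      using x(2) by blast
  qed
  have "embedding_map X W.mtopology i"
    by (rule injective_closed_imp_embedding_map[OF ci clo i_inj])
  moreover have "closedin W.mtopology (i ` topspace X)"
    using clo by (simp add: closed_map_def)
  ultimately show ?thesis
    using cInl W.metrizable_space_mtopology unfolding i_def by blast
qed

text \<open>
  Test spaces for \<open>A\<close> on the type \<^typ>\<open>'z\<close> lead to test spaces for \<open>X\<close> on \<^typ>\<open>'z + 'a\<close>, where the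
  glued space lives. The case \<open>A = X\<close> transfers the AR property of \<open>X\<close> itself to the type \<^typ>\<open>'z\<close>.
\<close>
lemma AR_space_retract:
  fixes X :: "'a topology"
  assumes X: "AR_space TYPE('z + 'a) X" and A: "A retract_of_space X"
  shows "AR_space TYPE('z) (subtopology X A)"
  unfolding AR_space_iff
proof (intro conjI allI impI)
  have mX: "metrizable_space X"
    using X by (simp add: AR_space_iff)
  then show "metrizable_space (subtopology X A)"
    by (rule metrizable_space_subtopology)
  fix Z :: "'z topology" and e
  assume "metrizable_space Z \<and> embedding_map (subtopology X A) Z e \<and>
          closedin Z (e ` topspace (subtopology X A))"
  moreover have AX: "A \<subseteq> topspace X"
    using A by (simp add: retract_of_space_def)
  ultimately have Z: "metrizable_space Z" and e: "embedding_map (subtopology X A) Z e"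
    and cl: "closedin Z (e ` A)" and ta: "topspace (subtopology X A) = A"
    by (auto simp: Int_absorb1)
  obtain \<rho> where \<rho>: "continuous_map X (subtopology X A) \<rho>" "\<And>x. x \<in> A \<Longrightarrow> \<rho> x = x"
    using A by (auto simp: retract_of_space_def)
  define i :: "'a \<Rightarrow> 'z + 'a" where "i = (\<lambda>x. if x \<in> A then Inl (e x) else Inr x)"
  obtain W :: "('z + 'a) topology" where W: "metrizable_space W" "continuous_map Z W Inl"
    "embedding_map X W i" "closedin W (i ` topspace X)"
    using metrizable_gluing_along_retract[OF mX Z \<rho> AX e cl] unfolding i_def by blast
  then have "(i ` topspace X) retract_of_space W"
    using X unfolding AR_space_iff by blast
  then obtain R where R: "continuous_map W (subtopology W (i ` topspace X)) R"
      "\<And>w. w \<in> i ` topspace X \<Longrightarrow> R w = w"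
    by (auto simp: retract_of_space_def)
  obtain s where s: "continuous_map (subtopology W (i ` topspace X)) X s"
      "\<And>x. x \<in> topspace X \<Longrightarrow> s (i x) = x"
    using W(3) by (auto simp: embedding_map_def homeomorphic_map_maps homeomorphic_maps_def)
  have "continuous_map (subtopology X A) (subtopology Z (e ` A)) e"
    using e ta by (simp add: embedding_map_def homeomorphic_imp_continuous_map)
  then have "continuous_map Z (subtopology Z (e ` A)) (e \<circ> \<rho> \<circ> s \<circ> R \<circ> Inl)"
    using W(2) R(1) s(1) \<rho>(1) by (auto intro!: continuous_map_compose)
  moreover have "(e \<circ> \<rho> \<circ> s \<circ> R \<circ> Inl) (e x) = e x" if "x \<in> A" for x
  proof -
    have x: "Inl (e x) = i x" "x \<in> topspace X"
      using that AX by (auto simp: i_def)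
    then show ?thesis
      using R(2) s(2) \<rho>(2) that by simp
  qed
  ultimately have "(e ` A) retract_of_space Z"
    using closedin_subset[OF cl] unfolding retract_of_space_def by blast
  then show "(e ` topspace (subtopology X A)) retract_of_space Z"
    using ta by simp
qed

section \<open>Spaces with an equivariant mean\<close>

theorem theorem3p3:
  fixes G :: "('g, 'm) monoid_scheme" and T :: "'g topology"
    and X :: "'a topology" and \<phi> :: "'g \<Rightarrow> 'a \<Rightarrow> 'a" and n :: nat
  assumes "G_space G T X \<phi>"
    and "finite (carrier G)"
    and "order G dvd n"
    and "\<exists>p. equivariant_n_mean G n X \<phi> p"
  shows "(\<forall>H. subgroup H G \<longrightarrow> fixed_set H \<phi> X retract_of_space X) \<and>
         (AR_space TYPE('z + 'a) X \<longrightarrow>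
            (\<forall>H. subgroup H G \<longrightarrow>
               AR_space TYPE('z) (subtopology X (fixed_set H \<phi> X))) \<and>
            G_AR TYPE('z) G T X \<phi>)"
proof -
  obtain p where p: "equivariant_n_mean G n X \<phi> p"
    using assms(4) by blast
  interpret group G
    using assms(1) by (simp add: G_space_def Hausdorff_topological_group_def)
  have fixed: "fixed_set H \<phi> X retract_of_space X" if H: "subgroup H G" for H
  proof (rule fixed_set_retract[OF assms(1) H _ _ p])
    show "finite H"
      using H assms(2) subgroup.subset finite_subset by metis
    show "card H dvd n"
      using lagrange[OF H] assms(3) by (metis dvd_mult_right)
  qed
  moreover have "G_AR TYPE('z) G T X \<phi>" if X: "AR_space TYPE('z + 'a) X"
  proof -
    have "topspace X retract_of_space X"
      by (auto simp: retract_of_space_def intro: exI[of _ id])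
    then have AR: "AR_space TYPE('z) X"
      using AR_space_retract[OF X] by fastforce
    then show ?thesis
      using assms(1) average_retraction[OF assms(1) _ assms(2,3) p]
      unfolding G_AR_def AR_space_iff by blast
  qed
  ultimately show ?thesis
    using AR_space_retract by blast
qed

end
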